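(* Let $\mathbb{X},\mathbb{Y},\mathbb{E}$ be finite-dimensional Euclidean spaces, let $\Phi:\mathbb{X}\to\mathbb{E}$ and $K:\mathbb{X}\to\mathbb{Y}$ be linear operators, and let $g:\mathbb{Y}\to\mathbb{R}\cup\{\infty\}$ be a proper lower semicontinuous convex function. For $(b,\mu,v)\in\mathbb{E}\times(0,\infty)\times\mathbb{Y}$ define $$\widetilde S_{LS}(b,\mu,v):=\Big\{(x,y)\in\mathbb{X}\times\mathbb{Y}\;\Big|\;0=K^*y+\tfrac1\mu\Phi^*(\Phi x-b),\ \ v\in-Kx+\partial g^*(y)\Big\}.$$ Let $(\bar b,\bar\mu)\in\mathbb{E}\times(0,\infty)$ and $(\bar x,\bar y)\in\widetilde S_{LS}(\bar b,\bar\mu,0)$, and assume that the Robinson constraint qualification $0\in\mathrm{int}\,(K\bar x+\mathrm{Im}\,K-\mathrm{dom}\,g)$ holds. Suppose that $g$ satisfies the primal-dual quadratic growth condition at $K\bar x$ for $\bar y$. Then $\widetilde S_{LS}$ is isolated calm at $(\bar b,\bar\mu,0)$ for $(\bar x,\bar y)$ if and only if $$\mathrm{Ker}\,\Phi\cap K^{-1}\big(T_{\partial g^*(\bar y)}(K\bar x)\big)=\{0\},$$ provided that one of the following conditions holds: (i) the set $\partial g^*(\bar y)$ is polyhedral and $\mathrm{Ker}\,K^*\cap T_{\partial g(K\bar x)}(\bar y)=\{0\}$; (ii) $\mathrm{Im}\,K\cap\mathrm{ri}\,(\partial g^*(\bar y))\ne\emptyset$ and $\mathrm{Ker}\,K^*\cap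 T_{\partial g(K\bar x)}(\bar y)=\{0\}$; (iii) $\mathrm{Ker}\,K^*\cap N_{\partial g^*(\bar y)}(K\bar x)=\{0\}$.
   Context: $g^*$ is the Fenchel conjugate of $g$, $\partial$ the convex subdifferential, $K^*$ the adjoint, $\mathrm{ri}$ the relative interior, and $N_\Omega(\bar u)=\{v\mid\langle v,u-\bar u\rangle\le0\ \forall u\in\Omega\}$ the normal cone to a convex set $\Omega$ at $\bar u\in\Omega$. Tangent cone: $T_\Omega(\bar u):=\{w\mid\exists\,t_k\downarrow0,\ w_k\to w,\ \bar u+t_kw_k\in\Omega\}$ for $\bar u\in\Omega$. Isolated calmness: a set-valued mapping $S$ between Euclidean spaces (or from an open subset of one) is isolated calm at $\bar a$ for $\bar z\in S(\bar a)$ if there exist $\ell>0$ and neighborhoods $U$ of $\bar z$ and $V$ of $\bar a$ such that $\|z-\bar z\|\le\ell\|a-\bar a\|$ whenever $a\in V$ and $z\in S(a)\cap U$. Quadratic growth condition: a proper lower semicontinuous convex function $\varphi$ satisfies it at $\bar u\in\mathrm{dom}\,\varphi$ for $\bar v\in\partial\varphi(\bar u)$ if there exist $c,\varepsilon>0$ such that $\varphi(u)\ge\varphi(\bar u)+\langle\bar v,u-\bar u\rangle+\frac c2[d(u;(\partial\varphi)^{-1}(\bar v))]^2$ for all $u$ with $\|u-\bar u\|<\varepsilon$, where $d(\cdot;\Omega)$ is the distance to $\Omega$. The function $\varphi$ satisfies the primal-dual quadratic growth condition at $\bar u$ for $\bar v$ if $\varphi$ satisfies the quadratic growth condition at $\bar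 u$ for $\bar v$ and $\varphi^*$ satisfies the quadratic growth condition at $\bar v$ for $\bar u$. *)

theory Defs
  imports "HOL-Analysis.Analysis"
begin

text \<open>Functions into the reals extended by plus infinity are modelled as functions into
  \<^typ>\<open>ereal\<close>; \<open>proper_fun\<close> excludes the value minus infinity.\<close>

definition eff_domain :: "('a \<Rightarrow> ereal) \<Rightarrow> 'a set" where
  "eff_domain \<phi> = {u. \<phi> u < \<infinity>}"

definition proper_fun :: "('a \<Rightarrow> ereal) \<Rightarrow> bool" where
  "proper_fun \<phi> \<longleftrightarrow> (\<forall>u. \<phi> u \<noteq> -\<infinity>) \<and> eff_domain \<phi> \<noteq> {}"

definition lsc_fun :: "('a::topological_space \<Rightarrow> ereal) \<Rightarrow> bool" where
  "lsc_fun \<phi> \<longleftrightarrow> (\<forall>u. \<phi> u \<le> Liminf (at u) \<phi>)"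

text \<open>Only used for functions avoiding minus infinity, so that the right-hand side never
  involves a difference of infinities; note \<open>0 * \<infinity> = 0\<close> in \<^typ>\<open>ereal\<close>.\<close>

definition convex_fun :: "('a::real_vector \<Rightarrow> ereal) \<Rightarrow> bool" where
  "convex_fun \<phi> \<longleftrightarrow>
    (\<forall>u w. \<forall>s\<ge>0. \<forall>t\<ge>0. s + t = (1::real) \<longrightarrow>
      \<phi> (s *\<^sub>R u + t *\<^sub>R w) \<le> ereal s * \<phi> u + ereal t * \<phi> w)"

definition fenchel_conj :: "('a::real_inner \<Rightarrow> ereal) \<Rightarrow> 'a \<Rightarrow> ereal" where
  "fenchel_conj \<phi> v = (SUP u. ereal (v \<bullet> u) - \<phi> u)"

text \<open>The subdifferential is empty at points where the function is not finite.\<close>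

definition subdiff :: "('a::real_inner \<Rightarrow> ereal) \<Rightarrow> 'a \<Rightarrow> 'a set" where
  "subdiff \<phi> u = {v. \<bar>\<phi> u\<bar> \<noteq> \<infinity> \<and> (\<forall>w. \<phi> w \<ge> \<phi> u + ereal (v \<bullet> (w - u)))}"

definition normal_cone :: "'a::real_inner set \<Rightarrow> 'a \<Rightarrow> 'a set" where
  "normal_cone \<Omega> u = {v. \<forall>w\<in>\<Omega>. v \<bullet> (w - u) \<le> 0}"

definition tangent_cone :: "'a::real_normed_vector set \<Rightarrow> 'a \<Rightarrow> 'a set" where
  "tangent_cone \<Omega> u =
    {w. \<exists>(t :: nat \<Rightarrow> real) (W :: nat \<Rightarrow> 'a).
          (\<forall>k. t k > 0) \<and> t \<longlonglongrightarrow> 0 \<and> W \<longlonglongrightarrow> w \<and> (\<forall>k. u + t k *\<^sub>R W k \<in> \<Omega>)}"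

text \<open>\<open>D\<close> is the open domain of the set-valued mapping \<open>S\<close>; values of \<open>S\<close> outside \<open>D\<close>
  are irrelevant.\<close>

definition isolated_calm ::
  "'a::real_normed_vector set \<Rightarrow> ('a \<Rightarrow> 'b::real_normed_vector set) \<Rightarrow> 'a \<Rightarrow> 'b \<Rightarrow> bool" where
  "isolated_calm D S a z \<longleftrightarrow> a \<in> D \<and> z \<in> S a \<and>
    (\<exists>l>0. \<exists>U V. open U \<and> z \<in> U \<and> open V \<and> a \<in> V \<and>
      (\<forall>a'\<in>V \<inter> D. \<forall>z'\<in>S a' \<inter> U. norm (z' - z) \<le> l * norm (a' - a)))"

definition quadratic_growth ::
  "('a::real_inner \<Rightarrow> ereal) \<Rightarrow> 'a \<Rightarrow> 'a \<Rightarrow> bool" where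
  "quadratic_growth \<phi> u v \<longleftrightarrow> u \<in> eff_domain \<phi> \<and> v \<in> subdiff \<phi> u \<and>
    (\<exists>c>0. \<exists>\<epsilon>>0. \<forall>w. norm (w - u) < \<epsilon> \<longrightarrow>
      \<phi> w \<ge> \<phi> u + ereal (v \<bullet> (w - u)) + ereal (c / 2 * (infdist w {p. v \<in> subdiff \<phi> p})\<^sup>2))"

definition primal_dual_quadratic_growth ::
  "('a::real_inner \<Rightarrow> ereal) \<Rightarrow> 'a \<Rightarrow> 'a \<Rightarrow> bool" where
  "primal_dual_quadratic_growth \<phi> u v \<longleftrightarrow>
    quadratic_growth \<phi> u v \<and> quadratic_growth (fenchel_conj \<phi>) v u"

definition S_LS ::
  "('x::euclidean_space \<Rightarrow> 'e::euclidean_space) \<Rightarrow> ('x \<Rightarrow> 'y::euclidean_space) \<Rightarrow>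
    ('y \<Rightarrow> ereal) \<Rightarrow> 'e \<times> real \<times> 'y \<Rightarrow> ('x \<times> 'y) set" where
  "S_LS \<Phi> K g = (\<lambda>(b, \<mu>, v). {(x, y).
      0 = adjoint K y + (1 / \<mu>) *\<^sub>R adjoint \<Phi> (\<Phi> x - b) \<and>
      v \<in> (\<lambda>p. - K x + p) ` subdiff (fenchel_conj g) y})"

definition S_LS_domain :: "('e \<times> real \<times> 'y) set" where
  "S_LS_domain = UNIV \<times> {0<..} \<times> UNIV"

definition robinson_cq ::
  "('x::euclidean_space \<Rightarrow> 'y::euclidean_space) \<Rightarrow> ('y \<Rightarrow> ereal) \<Rightarrow> 'x \<Rightarrow> bool" where
  "robinson_cq K g x \<longleftrightarrow>
    0 \<in> interior {K x + p - q | p q. p \<in> range K \<and> q \<in> eff_domain g}"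

definition Ker :: "('a \<Rightarrow> 'b::zero) \<Rightarrow> 'a set" where
  "Ker L = {x. L x = 0}"

end

theory Submission
  imports Defs
begin

text \<open>Write \<open>u = K xbar\<close>, and consider the solution sets \<open>\<partial>g*(ybar)\<close> of \<open>ybar \<in> \<partial>g(p)\<close> and
  \<open>\<partial>g(u)\<close> of \<open>u \<in> \<partial>g*(p)\<close>; that they are these subdifferentials is the inversion
  \<open>(\<partial>g)\<inverse> = \<partial>g*\<close> proved in \<open>subdiff_fenchel_conj_iff\<close>.

  Necessity rests on the parameter \<open>v\<close>, which enters the second inclusion additively. Moving
  from \<open>xbar\<close> along a kernel direction \<open>w\<close> of \<open>\<Phi>\<close> with \<open>K w\<close> tangent to \<open>\<partial>g*(ybar)\<close> leaves
  the linear equation intact and violates the inclusion only by a quantity of smaller order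
  than the step. Taking that quantity as \<open>v\<close> produces exact solutions, so isolated calmness
  forces \<open>w = 0\<close>.

  For sufficiency, suppose that solutions deviate from \<open>(xbar, ybar)\<close> by much more than their
  parameters do, and let \<open>(w, q)\<close> be a limit of the normalised deviations. The linear equation
  gives \<open>q \<bullet> K w \<le> 0\<close>. By \<open>quadratic_growth_imp_monotone\<close>, primal and dual quadratic growth
  bound \<open>q \<bullet> K w\<close> from below by the squared relative distances to the two solution sets.
  Hence these distances are negligible, \<open>K w\<close> and \<open>q\<close> are tangent to the solution sets,
  \<open>\<Phi> w = 0\<close> and \<open>K* q = 0\<close>. The kernel condition kills \<open>w\<close>. Each of the three alternative
  qualification conditions kills \<open>q\<close>; the one on the normal cone does so because the tangent
  cone of \<open>\<partial>g(u)\<close> at \<open>ybar\<close> lies inside the normal cone of \<open>\<partial>g*(ybar)\<close> at \<open>u\<close>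
  (\<open>tangent_cone_subdiff_subset_normal_cone\<close>).\<close>

section \<open>Inverting the subdifferential of the conjugate\<close>

lemma convex_epigraph:
  assumes "convex_fun g"
  shows "convex {(w, \<tau>). g w \<le> ereal \<tau>}"
proof (rule convexI, clarsimp)
  fix w1 \<tau>1 w2 \<tau>2 and s t :: real
  assume h: "g w1 \<le> ereal \<tau>1" "g w2 \<le> ereal \<tau>2" "0 \<le> s" "0 \<le> t" "s + t = 1"
  have "g (s *\<^sub>R w1 + t *\<^sub>R w2) \<le> ereal s * g w1 + ereal t * g w2"
    using assms h unfolding convex_fun_def by blast
  also have "\<dots> \<le> ereal s * ereal \<tau>1 + ereal t * ereal \<tau>2"
    using h by (intro add_mono ereal_mult_left_mono) auto
  finally show "g (s *\<^sub>R w1 + t *\<^sub>R w2) \<le> ereal (s * \<tau>1 + t * \<tau>2)" by simp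
qed

lemma closed_epigraph:
  fixes g :: "'a::euclidean_space \<Rightarrow> ereal"
  assumes "lsc_fun g"
  shows "closed {(w, \<tau>). g w \<le> ereal \<tau>}"
proof -
  have "open (- {(w, \<tau>). g w \<le> ereal \<tau>})"
  proof (rule Topological_Spaces.openI)
    fix z assume z: "z \<in> - {(w, \<tau>). g w \<le> ereal \<tau>}"
    obtain w \<tau> where [simp]: "z = (w, \<tau>)" by (cases z)
    have "ereal \<tau> < g w" using z by (simp add: not_le)
    then obtain \<sigma> where \<sigma>: "\<tau> < \<sigma>" "ereal \<sigma> < g w"
      by (metis ereal_dense2 ereal_less_eq(3) less_ereal.simps(1))
    have "ereal \<sigma> < Liminf (at w) g"
      using assms \<sigma>(2) unfolding lsc_fun_def by (meson less_le_trans)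
    then have "eventually (\<lambda>p. ereal \<sigma> < g p) (at w)"
      by (rule less_LiminfD)
    then have "eventually (\<lambda>p. ereal \<sigma> < g p) (nhds w)"
      using \<sigma>(2) by (auto simp: eventually_at_filter elim: eventually_mono)
    then obtain A where A: "open A" "w \<in> A" "\<forall>p\<in>A. ereal \<sigma> < g p"
      by (auto simp: eventually_nhds)
    have "\<not> g p \<le> ereal s" if "p \<in> A" "s < \<sigma>" for p s
      using A(3) that by (meson le_less_trans less_asym less_ereal.simps(1))
    then have "A \<times> {..<\<sigma>} \<subseteq> - {(w, \<tau>). g w \<le> ereal \<tau>}" by auto
    then show "\<exists>T. open T \<and> z \<in> T \<and> T \<subseteq> - {(w, \<tau>). g w \<le> ereal \<tau>}"
      using A \<sigma>(1) by (intro exI[of _ "A \<times> {..<\<sigma>}"]) (auto intro: open_Times)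
  qed
  then show ?thesis by (simp add: closed_def)
qed

lemma fenchel_conj_at_subgradient:
  assumes "y \<in> subdiff g u"
  shows "fenchel_conj g y = ereal (y \<bullet> u) - g u"
proof (rule antisym)
  obtain r where r: "g u = ereal r"
    using assms unfolding subdiff_def by (cases "g u") auto
  show "fenchel_conj g y \<le> ereal (y \<bullet> u) - g u"
    unfolding fenchel_conj_def
  proof (rule SUP_least)
    fix w
    have "g u + ereal (y \<bullet> (w - u)) \<le> g w"
      using assms unfolding subdiff_def by blast
    then show "ereal (y \<bullet> w) - g w \<le> ereal (y \<bullet> u) - g u"
      by (cases "g w") (auto simp: r inner_diff_right)
  qed
  show "ereal (y \<bullet> u) - g u \<le> fenchel_conj g y"
    unfolding fenchel_conj_def by (rule SUP_upper) simp
qed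

text \<open>This is the part of the Fenchel-Moreau theorem that matters here. If the Fenchel-Young
  equality failed at \<^term>\<open>u\<close>, the point of the affine minorant \<open>w \<mapsto> y \<bullet> w - g*(y)\<close> above
  \<^term>\<open>u\<close> would lie outside the epigraph. A strictly separating hyperplane gives a slope
  \<open>y'\<close> violating the subgradient inequality of the conjugate: \<open>y'\<close> is the slope of the
  hyperplane, or, if the hyperplane is vertical, \<^term>\<open>y\<close> tilted by its normal.\<close>

lemma subdiff_fenchel_conj_iff:
  fixes g :: "'a::euclidean_space \<Rightarrow> ereal"
  assumes "proper_fun g" "lsc_fun g" "convex_fun g"
  shows "u \<in> subdiff (fenchel_conj g) y \<longleftrightarrow> y \<in> subdiff g u"
proof
  assume y: "y \<in> subdiff g u"
  then obtain r where r: "g u = ereal r"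
    unfolding subdiff_def by (cases "g u") auto
  have "fenchel_conj g y + ereal (u \<bullet> (z - y)) \<le> fenchel_conj g z" for z
  proof -
    have "ereal (z \<bullet> u) - g u \<le> fenchel_conj g z"
      unfolding fenchel_conj_def by (rule SUP_upper) simp
    then show ?thesis
      using fenchel_conj_at_subgradient[OF y]
      by (simp add: r inner_diff_right inner_commute)
  qed
  then show "u \<in> subdiff (fenchel_conj g) y"
    using fenchel_conj_at_subgradient[OF y] by (simp add: subdiff_def r)
next
  assume u: "u \<in> subdiff (fenchel_conj g) y"
  then obtain \<beta> where \<beta>: "fenchel_conj g y = ereal \<beta>"
    unfolding subdiff_def by (cases "fenchel_conj g y") auto
  have sub: "ereal (\<beta> + u \<bullet> (z - y)) \<le> fenchel_conj g z" for z
    using u \<beta> unfolding subdiff_def by force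
  have minor: "y \<bullet> w - \<beta> \<le> \<tau>" if "g w \<le> ereal \<tau>" for w \<tau>
  proof -
    have "ereal (y \<bullet> w) - g w \<le> ereal \<beta>"
      unfolding \<beta>[symmetric] fenchel_conj_def by (rule SUP_upper) simp
    then show ?thesis using that by (cases "g w") auto
  qed
  have conj_le: "fenchel_conj g z \<le> ereal \<delta>"
    if "\<And>w \<tau>. g w \<le> ereal \<tau> \<Longrightarrow> z \<bullet> w - \<tau> \<le> \<delta>" for z \<delta>
    unfolding fenchel_conj_def
  proof (rule SUP_least)
    fix w
    show "ereal (z \<bullet> w) - g w \<le> ereal \<delta>"
      using that[of w] assms(1) unfolding proper_fun_def by (cases "g w") auto
  qed
  define \<alpha> where "\<alpha> = y \<bullet> u - \<beta>"
  have epi: "g u \<le> ereal \<alpha>"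
  proof (rule ccontr)
    let ?E = "{(w, \<tau>). g w \<le> ereal \<tau>}"
    assume "\<not> g u \<le> ereal \<alpha>"
    then have "(u, \<alpha>) \<notin> ?E" by simp
    then obtain a \<gamma> where a: "a \<bullet> (u, \<alpha>) < \<gamma>" "\<forall>p\<in>?E. \<gamma> < a \<bullet> p"
      using separating_hyperplane_closed_point
        [OF convex_epigraph[OF assms(3)] closed_epigraph[OF assms(2)]] by blast
    obtain s r where [simp]: "a = (s, r)" by (cases a)
    have below: "s \<bullet> u + r * \<alpha> < \<gamma>" using a(1) by (simp add: inner_prod_def)
    have above: "\<gamma> < s \<bullet> w + r * \<tau>" if "g w \<le> ereal \<tau>" for w \<tau>
      using a(2) that by (force simp: inner_prod_def)
    obtain w0 \<tau>0 where w0: "g w0 \<le> ereal \<tau>0"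
    proof -
      obtain w0 where "g w0 < \<infinity>" using assms(1) unfolding proper_fun_def eff_domain_def by blast
      then show ?thesis using that[of w0 "real_of_ereal (g w0)"] assms(1)
        unfolding proper_fun_def by (cases "g w0") auto
    qed
    have "r \<ge> 0"
    proof (rule ccontr)
      assume neg: "\<not> r \<ge> 0"
      define \<tau> where "\<tau> = max \<tau>0 ((\<gamma> - s \<bullet> w0) / r)"
      have "g w0 \<le> ereal \<tau>"
        using w0 unfolding \<tau>_def by (meson ereal_less_eq(3) max.cobounded1 order_trans)
      then have "\<gamma> < s \<bullet> w0 + r * \<tau>" by (rule above)
      moreover have "r * \<tau> \<le> r * ((\<gamma> - s \<bullet> w0) / r)"
        unfolding \<tau>_def using neg by (intro mult_left_mono_neg) auto
      ultimately show False using neg by simp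
    qed
    show False
    proof (cases "r = 0")
      case True
      have "fenchel_conj g (y - s) \<le> ereal (\<beta> - \<gamma>)"
      proof (rule conj_le)
        fix w \<tau> assume w: "g w \<le> ereal \<tau>"
        show "(y - s) \<bullet> w - \<tau> \<le> \<beta> - \<gamma>"
          using minor[OF w] above[OF w] True by (simp add: inner_diff_left)
      qed
      then have "ereal (\<beta> + u \<bullet> ((y - s) - y)) \<le> ereal (\<beta> - \<gamma>)"
        using sub order_trans by blast
      then show False using below True by (simp add: inner_commute)
    next
      case False
      then have r: "r > 0" using \<open>r \<ge> 0\<close> by simp
      define z where "z = (- (1 / r)) *\<^sub>R s"
      have "fenchel_conj g z \<le> ereal (- \<gamma> / r)"
      proof (rule conj_le)
        fix w \<tau> assume "g w \<le> ereal \<tau>"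
        show "z \<bullet> w - \<tau> \<le> - \<gamma> / r"
        proof -
          have "\<gamma> / r \<le> (s \<bullet> w + r * \<tau>) / r"
            using above[OF \<open>g w \<le> ereal \<tau>\<close>] r by (intro divide_right_mono) auto
          then show ?thesis using r by (simp add: z_def add_divide_distrib)
        qed
      qed
      then have "ereal (\<beta> + u \<bullet> (z - y)) \<le> ereal (- \<gamma> / r)"
        using sub order_trans by blast
      then have "\<beta> + u \<bullet> z - u \<bullet> y \<le> - \<gamma> / r" by (simp add: inner_diff_right)
      moreover have "(s \<bullet> u + r * \<alpha>) / r < \<gamma> / r"
        using below r by (rule divide_strict_right_mono)
      ultimately show False using r
        by (simp add: z_def \<alpha>_def add_divide_distrib inner_commute)
    qed
  qed
  moreover have "g u \<noteq> -\<infinity>" using assms(1) by (simp add: proper_fun_def)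
  ultimately obtain \<rho> where \<rho>: "g u = ereal \<rho>" "\<rho> \<le> \<alpha>" by (cases "g u") auto
  have "g u + ereal (y \<bullet> (w - u)) \<le> g w" for w
  proof (cases "g w")
    case (real \<tau>)
    then show ?thesis
      using minor[of w \<tau>] \<rho> by (simp add: \<alpha>_def inner_diff_right)
  qed (use assms(1) in \<open>auto simp: proper_fun_def\<close>)
  then show "y \<in> subdiff g u" using \<rho>(1) by (simp add: subdiff_def)
qed

section \<open>Quadratic growth and tangent directions\<close>

text \<open>Add the growth inequality at \<^term>\<open>u\<close> to the subgradient inequality of a nearby pair in
  the graph of the subdifferential: the function values cancel and leave a strengthening of
  monotonicity.\<close>

lemma quadratic_growth_imp_monotone:
  assumes "quadratic_growth \<phi> u v"
  obtains c \<epsilon> where "c > 0" "\<epsilon> > 0"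
    "\<And>p y. \<lbrakk>norm (p - u) < \<epsilon>; y \<in> subdiff \<phi> p\<rbrakk> \<Longrightarrow>
      c / 2 * (infdist p {p. v \<in> subdiff \<phi> p})\<^sup>2 \<le> (y - v) \<bullet> (p - u)"
proof -
  obtain c \<epsilon> where c: "c > 0" "\<epsilon> > 0" and growth: "\<And>w. norm (w - u) < \<epsilon> \<Longrightarrow>
      \<phi> u + ereal (v \<bullet> (w - u)) + ereal (c / 2 * (infdist w {p. v \<in> subdiff \<phi> p})\<^sup>2) \<le> \<phi> w"
    using assms unfolding quadratic_growth_def by blast
  obtain r where r: "\<phi> u = ereal r"
    using assms unfolding quadratic_growth_def subdiff_def by (cases "\<phi> u") auto
  show thesis
  proof (rule that[OF c])
    fix p y
    assume p: "norm (p - u) < \<epsilon>" and y: "y \<in> subdiff \<phi> p"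
    obtain q where q: "\<phi> p = ereal q"
      using y unfolding subdiff_def by (cases "\<phi> p") auto
    have "\<phi> p + ereal (y \<bullet> (u - p)) \<le> \<phi> u" using y unfolding subdiff_def by blast
    then show "c / 2 * (infdist p {p. v \<in> subdiff \<phi> p})\<^sup>2 \<le> (y - v) \<bullet> (p - u)"
      using growth[OF p] by (simp add: r q inner_diff_left inner_diff_right)
  qed
qed

lemma tangent_cone_of_infdist:
  assumes "S \<noteq> {}" and t: "\<And>k. t k > 0" "t \<longlonglongrightarrow> 0"
    and dir: "(\<lambda>k. (1 / t k) *\<^sub>R (u k - a)) \<longlonglongrightarrow> d"
    and small: "(\<lambda>k. infdist (u k) S / t k) \<longlonglongrightarrow> 0"
  shows "d \<in> tangent_cone S a"
proof -
  have "\<exists>p\<in>S. dist (u k) p < infdist (u k) S + t k / Suc k" for k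
  proof -
    have "infdist (u k) S < infdist (u k) S + t k / Suc k" using t(1) by simp
    moreover have "bdd_below (dist (u k) ` S)" by (intro bdd_belowI[of _ 0]) auto
    ultimately show ?thesis
      using assms(1) cINF_less_iff[of S "dist (u k)"] unfolding infdist_def by metis
  qed
  then obtain p where p: "\<And>k. p k \<in> S" "\<And>k. dist (u k) (p k) < infdist (u k) S + t k / Suc k"
    by metis
  define W where "W k = (1 / t k) *\<^sub>R (p k - a)" for k
  have bound: "norm (W k - (1 / t k) *\<^sub>R (u k - a)) \<le> infdist (u k) S / t k + 1 / Suc k" for k
  proof -
    have "W k - (1 / t k) *\<^sub>R (u k - a) = (1 / t k) *\<^sub>R (p k - u k)"
      by (simp add: W_def algebra_simps)
    then have "norm (W k - (1 / t k) *\<^sub>R (u k - a)) = dist (u k) (p k) / t k"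
      using t(1)[of k] by (simp add: dist_norm norm_minus_commute)
    also have "\<dots> \<le> (infdist (u k) S + t k / Suc k) / t k"
      using p(2)[of k] t(1)[of k] by (intro divide_right_mono) auto
    also have "\<dots> = infdist (u k) S / t k + 1 / Suc k"
      using t(1)[of k] by (simp add: add_divide_distrib)
    finally show ?thesis .
  qed
  have "(\<lambda>k. infdist (u k) S / t k + 1 / Suc k) \<longlonglongrightarrow> 0"
    using tendsto_add[OF small LIMSEQ_Suc[OF lim_1_over_n]] by simp
  then have "(\<lambda>k. W k - (1 / t k) *\<^sub>R (u k - a)) \<longlonglongrightarrow> 0"
    by (rule Lim_null_comparison[OF always_eventually[OF allI[OF bound]]])
  from tendsto_add[OF this dir] have "W \<longlonglongrightarrow> d" by simp
  moreover have "a + t k *\<^sub>R W k \<in> S" for k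
    using p(1)[of k] t(1)[of k] by (simp add: W_def)
  ultimately show ?thesis using t unfolding tangent_cone_def by blast
qed

text \<open>Each increment \<open>y - v\<close> within the subdifferential at \<^term>\<open>u\<close> is normal, by
  monotonicity, to the solution set of \<open>v \<in> \<partial>g(p)\<close>; tangent vectors are limits of positive
  multiples of such increments. This reduces a condition on the normal cone to the one on the
  tangent cone.\<close>

lemma tangent_cone_subdiff_subset_normal_cone:
  assumes "v \<in> subdiff g u"
  shows "tangent_cone (subdiff g u) v \<subseteq> normal_cone {p. v \<in> subdiff g p} u"
proof (clarsimp simp: tangent_cone_def normal_cone_def)
  fix d p and t :: "nat \<Rightarrow> real" and W
  assume p: "v \<in> subdiff g p" and t: "\<forall>k. 0 < t k" and W: "W \<longlonglongrightarrow> d"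
    and mem: "\<forall>k. v + t k *\<^sub>R W k \<in> subdiff g u"
  have "W k \<bullet> (p - u) \<le> 0" for k
  proof -
    have le: "g u + ereal ((v + t k *\<^sub>R W k) \<bullet> (p - u)) \<le> g p"
      using mem unfolding subdiff_def by blast
    have "g p + ereal (v \<bullet> (u - p)) \<le> g u" using p unfolding subdiff_def by blast
    moreover obtain r where "g u = ereal r"
      using assms unfolding subdiff_def by (cases "g u") auto
    moreover obtain q where "g p = ereal q"
      using p unfolding subdiff_def by (cases "g p") auto
    ultimately have "t k * (W k \<bullet> (p - u)) \<le> 0"
      using le by (simp add: inner_diff_right inner_add_left algebra_simps)
    moreover have "0 < t k" using t by blast
    ultimately show ?thesis by (simp add: mult_le_0_iff)
  qed
  moreover have "(\<lambda>k. W k \<bullet> (p - u)) \<longlonglongrightarrow> d \<bullet> (p - u)" by (intro tendsto_intros W)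
  ultimately show "d \<bullet> (p - u) \<le> 0" by (intro LIMSEQ_le_const2) auto
qed

section \<open>Isolated calmness of the solution map\<close>

text \<open>The step lengths \<open>t k\<close> are the distances of the solutions to \<^term>\<open>z\<close>, so the normalised
  increments lie on a compact sphere.\<close>

lemma not_isolated_calm_sequence:
  fixes S :: "'a::real_normed_vector \<Rightarrow> 'b::euclidean_space set"
  assumes "\<not> isolated_calm D S a z" "a \<in> D" "z \<in> S a"
  obtains A Z t d where "\<And>k::nat. A k \<in> D" "\<And>k. Z k \<in> S (A k)" "\<And>k. t k > 0" "t \<longlonglongrightarrow> 0"
    "norm d = 1" "(\<lambda>k. (1 / t k) *\<^sub>R (Z k - z)) \<longlonglongrightarrow> d"
    "(\<lambda>k. (1 / t k) *\<^sub>R (A k - a)) \<longlonglongrightarrow> 0"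
proof -
  have "\<exists>a'\<in>D. \<exists>z'\<in>S a'. norm (z' - z) < 1 / Suc k \<and> Suc k * norm (a' - a) < norm (z' - z)"
    for k :: nat
  proof (rule ccontr)
    assume no: "\<not> ?thesis"
    have "\<forall>a'\<in>UNIV \<inter> D. \<forall>z'\<in>S a' \<inter> ball z (1 / Suc k).
        norm (z' - z) \<le> real (Suc k) * norm (a' - a)"
      using no by (force simp: dist_norm norm_minus_commute not_less)
    then have "isolated_calm D S a z"
      unfolding isolated_calm_def using assms(2,3)
      by (intro conjI exI[of _ "real (Suc k)"] exI[of _ "ball z (1 / Suc k)"] exI[of _ UNIV])
        auto
    with assms(1) show False by contradiction
  qed
  then obtain A Z where AZ: "\<And>k. A k \<in> D" "\<And>k. Z k \<in> S (A k)"
      "\<And>k::nat. norm (Z k - z) < 1 / Suc k"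
      "\<And>k. Suc k * norm (A k - a) < norm (Z k - z)"
    by metis
  define t where "t k = norm (Z k - z)" for k
  have t: "t k > 0" for k
    using AZ(4)[of k] unfolding t_def
    by (meson le_less_trans mult_nonneg_nonneg norm_ge_zero of_nat_0_le_iff)
  have t0: "t \<longlonglongrightarrow> 0"
    by (rule Lim_null_comparison[OF _ LIMSEQ_Suc[OF lim_1_over_n]])
      (use AZ(3) t_def in \<open>auto intro!: always_eventually less_imp_le\<close>)
  define N where "N k = (1 / t k) *\<^sub>R (Z k - z)" for k
  have "\<forall>k. N k \<in> sphere 0 1" using t by (auto simp: N_def t_def)
  then obtain d \<sigma> where d: "d \<in> sphere 0 1" "strict_mono \<sigma>" "(N \<circ> \<sigma>) \<longlonglongrightarrow> d"
    using compact_sphere[of "0::'b" 1] unfolding compact_def by metis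
  have A0: "(\<lambda>k. (1 / t k) *\<^sub>R (A k - a)) \<longlonglongrightarrow> 0"
  proof (rule Lim_null_comparison[OF always_eventually LIMSEQ_Suc[OF lim_1_over_n]], rule allI)
    fix k
    have "norm ((1 / t k) *\<^sub>R (A k - a)) = norm (A k - a) / t k"
      using t[of k] by simp
    also have "\<dots> \<le> 1 / real (Suc k)"
      using AZ(4)[of k] t[of k] by (simp add: t_def[symmetric] field_simps)
    finally show "norm ((1 / t k) *\<^sub>R (A k - a)) \<le> 1 / real (Suc k)" .
  qed
  show thesis
  proof (rule that[of "A \<circ> \<sigma>" "Z \<circ> \<sigma>" "t \<circ> \<sigma>" d])
    show "(t \<circ> \<sigma>) \<longlonglongrightarrow> 0" by (rule LIMSEQ_subseq_LIMSEQ[OF t0 d(2)])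
    show "(\<lambda>k. (1 / (t \<circ> \<sigma>) k) *\<^sub>R ((A \<circ> \<sigma>) k - a)) \<longlonglongrightarrow> 0"
      using LIMSEQ_subseq_LIMSEQ[OF A0 d(2)] by (simp add: o_def)
    show "(\<lambda>k. (1 / (t \<circ> \<sigma>) k) *\<^sub>R ((Z \<circ> \<sigma>) k - z)) \<longlonglongrightarrow> d"
      using d(3) by (simp add: o_def N_def)
  qed (use AZ t d(1) in auto)
qed

lemma mem_S_LS:
  "(x, y) \<in> S_LS \<Phi> K g (b, \<mu>, v) \<longleftrightarrow>
    0 = adjoint K y + (1 / \<mu>) *\<^sub>R adjoint \<Phi> (\<Phi> x - b) \<and> K x + v \<in> subdiff (fenchel_conj g) y"
proof -
  have "v \<in> (\<lambda>p. - K x + p) ` P \<longleftrightarrow> K x + v \<in> P" for P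
    by (auto simp: image_iff intro!: bexI[of _ "K x + v"])
  then show ?thesis by (simp add: S_LS_def)
qed

text \<open>The third parameter absorbs the gap between a tangent direction \<open>K w\<close> and the feasible
  directions \<open>W k\<close> approximating it: with \<^term>\<open>ybar\<close> kept, the point \<open>xbar + t k w\<close> solves the
  problem perturbed by \<open>v = t k (W k - K w)\<close>, which is of smaller order than \<open>t k\<close>.\<close>

lemma isolated_calm_imp_kernel_tangent_trivial:
  fixes \<Phi> :: "'x::euclidean_space \<Rightarrow> 'e::euclidean_space"
    and K :: "'x \<Rightarrow> 'y::euclidean_space"
  assumes lin: "linear \<Phi>" "linear K" and "\<mu>bar > 0"
    and calm: "isolated_calm S_LS_domain (S_LS \<Phi> K g) (bbar, \<mu>bar, 0) (xbar, ybar)"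
  shows "Ker \<Phi> \<inter> K -` tangent_cone (subdiff (fenchel_conj g) ybar) (K xbar) \<subseteq> {0}"
proof
  fix w
  assume "w \<in> Ker \<Phi> \<inter> K -` tangent_cone (subdiff (fenchel_conj g) ybar) (K xbar)"
  then obtain t W where \<Phi>w: "\<Phi> w = 0" and t: "\<And>k. t k > 0" "t \<longlonglongrightarrow> 0" and W: "W \<longlonglongrightarrow> K w"
      and mem: "\<And>k. K xbar + t k *\<^sub>R W k \<in> subdiff (fenchel_conj g) ybar"
    unfolding Ker_def tangent_cone_def by auto
  have sol: "(xbar, ybar) \<in> S_LS \<Phi> K g (bbar, \<mu>bar, 0)"
    using calm unfolding isolated_calm_def by blast
  obtain l U V where l: "l > 0" "open U" "(xbar, ybar) \<in> U" "open V" "(bbar, \<mu>bar, 0) \<in> V"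
      and bound: "\<And>a' z'. \<lbrakk>a' \<in> V \<inter> S_LS_domain; z' \<in> S_LS \<Phi> K g a' \<inter> U\<rbrakk> \<Longrightarrow>
        norm (z' - (xbar, ybar)) \<le> l * norm (a' - (bbar, \<mu>bar, 0))"
    using calm unfolding isolated_calm_def by blast
  define X where "X k = xbar + t k *\<^sub>R w" for k
  define v where "v k = t k *\<^sub>R (W k - K w)" for k
  have "v \<longlonglongrightarrow> 0 *\<^sub>R (K w - K w)"
    unfolding v_def by (intro tendsto_intros t W)
  then have "(\<lambda>k. (bbar, \<mu>bar, v k)) \<longlonglongrightarrow> (bbar, \<mu>bar, 0)" by (intro tendsto_intros) simp
  then have inV: "eventually (\<lambda>k. (bbar, \<mu>bar, v k) \<in> V) sequentially"
    using l by (simp add: tendsto_def)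
  have "X \<longlonglongrightarrow> xbar + 0 *\<^sub>R w" unfolding X_def by (intro tendsto_intros t)
  then have "(\<lambda>k. (X k, ybar)) \<longlonglongrightarrow> (xbar, ybar)" by (intro tendsto_intros) simp
  then have inU: "eventually (\<lambda>k. (X k, ybar) \<in> U) sequentially"
    using l by (simp add: tendsto_def)
  have solk: "(X k, ybar) \<in> S_LS \<Phi> K g (bbar, \<mu>bar, v k)" for k
  proof -
    have "K (X k) + v k = K xbar + t k *\<^sub>R W k"
      using lin(2) by (simp add: X_def v_def linear_add linear_scale algebra_simps)
    moreover have "\<Phi> (X k) = \<Phi> xbar"
      using lin(1) \<Phi>w by (simp add: X_def linear_add linear_scale)
    ultimately show ?thesis using sol mem[of k] by (simp add: mem_S_LS)
  qed
  have "eventually (\<lambda>k. norm w \<le> l * norm (W k - K w)) sequentially"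
    using inU inV
  proof eventually_elim
    case (elim k)
    have "norm ((X k, ybar) - (xbar, ybar)) \<le> l * norm ((bbar, \<mu>bar, v k) - (bbar, \<mu>bar, 0))"
      by (rule bound) (use elim solk assms(3) in \<open>auto simp: S_LS_domain_def\<close>)
    then have "t k * norm w \<le> t k * (l * norm (W k - K w))"
      using t(1)[of k] by (simp add: X_def v_def norm_Pair)
    then show ?case using t(1)[of k] by simp
  qed
  moreover have "(\<lambda>k. l * norm (W k - K w)) \<longlonglongrightarrow> l * norm (K w - K w)"
    by (intro tendsto_intros W)
  ultimately have "norm w \<le> l * norm (K w - K w)"
    by (intro tendsto_lowerbound[where F = sequentially]) auto
  then show "w \<in> {0}" by simp
qed

text \<open>Let \<open>(w, q)\<close> be a limit of normalised increments of solutions whose parameters converge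
  faster. The linear equation gives \<open>\<mu>bar K* q + \<Phi>* \<Phi> w = 0\<close> in the limit, hence
  \<open>\<mu>bar (q \<bullet> K w) = - \<parallel>\<Phi> w\<parallel>\<^sup>2 \<le> 0\<close>, whereas growth bounds \<open>q \<bullet> K w\<close> from below by limits of
  squared relative distances to the two solution sets. So all these quantities vanish: \<open>K w\<close>
  and \<open>q\<close> are tangent, and \<open>\<Phi> w = 0\<close>, \<open>K* q = 0\<close>.\<close>

lemma isolated_calm_of_kernels_tangent_trivial:
  fixes \<Phi> :: "'x::euclidean_space \<Rightarrow> 'e::euclidean_space"
    and K :: "'x \<Rightarrow> 'y::euclidean_space"
    and g :: "'y \<Rightarrow> ereal"
  assumes lin: "linear \<Phi>" "linear K"
    and g: "proper_fun g" "lsc_fun g" "convex_fun g"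
    and \<mu>: "\<mu>bar > 0"
    and sol: "(xbar, ybar) \<in> S_LS \<Phi> K g (bbar, \<mu>bar, 0)"
    and growth: "primal_dual_quadratic_growth g (K xbar) ybar"
    and primal: "Ker \<Phi> \<inter> K -` tangent_cone (subdiff (fenchel_conj g) ybar) (K xbar) \<subseteq> {0}"
    and dual: "Ker (adjoint K) \<inter> tangent_cone (subdiff g (K xbar)) ybar \<subseteq> {0}"
  shows "isolated_calm S_LS_domain (S_LS \<Phi> K g) (bbar, \<mu>bar, 0) (xbar, ybar)"
proof (rule ccontr)
  let ?u = "K xbar" and ?\<Omega> = "subdiff (fenchel_conj g) ybar" and ?\<Omega>' = "subdiff g (K xbar)"
  have dom: "(bbar, \<mu>bar, 0::'y) \<in> S_LS_domain" using \<mu> by (simp add: S_LS_domain_def)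
  assume "\<not> ?thesis"
  then obtain A Z t d where AZ: "\<And>k::nat. A k \<in> S_LS_domain" "\<And>k. Z k \<in> S_LS \<Phi> K g (A k)"
      and t: "\<And>k. t k > 0" "t \<longlonglongrightarrow> 0" and d: "norm d = 1"
      and limZ: "(\<lambda>k. (1 / t k) *\<^sub>R (Z k - (xbar, ybar))) \<longlonglongrightarrow> d"
      and limA: "(\<lambda>k. (1 / t k) *\<^sub>R (A k - (bbar, \<mu>bar, 0))) \<longlonglongrightarrow> 0"
    using dom sol by (rule not_isolated_calm_sequence) (rule that)
  define w q where "w = fst d" and "q = snd d"
  define b m v where "b k = fst (A k)" and "m k = fst (snd (A k))" and "v k = snd (snd (A k))" for k
  define x y where "x k = fst (Z k)" and "y k = snd (Z k)" for k
  define u where "u k = K (x k) + v k" for k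
  have m: "m k > 0" for k using AZ(1)[of k] by (auto simp: S_LS_domain_def m_def)
  have "(x k, y k) \<in> S_LS \<Phi> K g (b k, m k, v k)" for k
    using AZ(2)[of k] by (simp add: x_def y_def b_def m_def v_def)
  then have eqn: "0 = adjoint K (y k) + (1 / m k) *\<^sub>R adjoint \<Phi> (\<Phi> (x k) - b k)"
    and graph: "u k \<in> subdiff (fenchel_conj g) (y k)" for k
    by (auto simp: mem_S_LS u_def)
  have eqn0: "0 = adjoint K ybar + (1 / \<mu>bar) *\<^sub>R adjoint \<Phi> (\<Phi> xbar - bbar)"
    and graph0: "?u \<in> ?\<Omega>"
    using sol by (auto simp: mem_S_LS)
  have graph': "y k \<in> subdiff g (u k)" for k
    using graph subdiff_fenchel_conj_iff[OF g] by blast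
  have \<Omega>: "{p. ybar \<in> subdiff g p} = ?\<Omega>" "{p. ?u \<in> subdiff (fenchel_conj g) p} = ?\<Omega>'"
    using subdiff_fenchel_conj_iff[OF g] by auto
  have graph0': "ybar \<in> ?\<Omega>'" using graph0 subdiff_fenchel_conj_iff[OF g] by blast

  have limx: "(\<lambda>k. (1 / t k) *\<^sub>R (x k - xbar)) \<longlonglongrightarrow> w"
    using tendsto_fst[OF limZ] by (simp add: x_def w_def)
  have limy: "(\<lambda>k. (1 / t k) *\<^sub>R (y k - ybar)) \<longlonglongrightarrow> q"
    using tendsto_snd[OF limZ] by (simp add: y_def q_def)
  have limb: "(\<lambda>k. (1 / t k) *\<^sub>R (b k - bbar)) \<longlonglongrightarrow> 0"
    using tendsto_fst[OF limA] by (simp add: b_def)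
  have limm: "(\<lambda>k. (1 / t k) *\<^sub>R (m k - \<mu>bar)) \<longlonglongrightarrow> 0"
    using tendsto_fst[OF tendsto_snd[OF limA]] by (simp add: m_def)
  have limv: "(\<lambda>k. (1 / t k) *\<^sub>R v k) \<longlonglongrightarrow> 0"
    using tendsto_snd[OF tendsto_snd[OF limA]] by (simp add: v_def)
  have blK: "bounded_linear K" and bl\<Phi>: "bounded_linear \<Phi>"
    and blK': "bounded_linear (adjoint K)" and bl\<Phi>': "bounded_linear (adjoint \<Phi>)"
    using lin by (auto intro!: linear_conv_bounded_linear[THEN iffD1] adjoint_linear)
  have "(\<lambda>k. K ((1 / t k) *\<^sub>R (x k - xbar)) + (1 / t k) *\<^sub>R v k) \<longlonglongrightarrow> K w + 0"
    by (intro tendsto_add bounded_linear.tendsto[OF blK] limx limv)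
  moreover have "K ((1 / t k) *\<^sub>R (x k - xbar)) + (1 / t k) *\<^sub>R v k = (1 / t k) *\<^sub>R (u k - ?u)" for k
    using lin(2) by (simp add: u_def linear_scale linear_diff algebra_simps)
  ultimately have limu: "(\<lambda>k. (1 / t k) *\<^sub>R (u k - ?u)) \<longlonglongrightarrow> K w" by simp
  have conv: "(\<lambda>k. s k - s0) \<longlonglongrightarrow> 0" if "(\<lambda>k. (1 / t k) *\<^sub>R (s k - s0)) \<longlonglongrightarrow> e"
    for s :: "nat \<Rightarrow> 'z::real_normed_vector" and s0 e
  proof -
    have "(\<lambda>k. t k *\<^sub>R ((1 / t k) *\<^sub>R (s k - s0))) \<longlonglongrightarrow> 0 *\<^sub>R e"
      by (intro tendsto_scaleR t that)
    moreover have "t k *\<^sub>R ((1 / t k) *\<^sub>R (s k - s0)) = s k - s0" for k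
      using t(1)[of k] by simp
    ultimately show ?thesis by simp
  qed

  have lim_eqn: "\<mu>bar *\<^sub>R adjoint K q + adjoint \<Phi> (\<Phi> w) = 0"
  proof -
    have "m k *\<^sub>R adjoint K ((1 / t k) *\<^sub>R (y k - ybar))
        + ((1 / t k) *\<^sub>R (m k - \<mu>bar)) *\<^sub>R adjoint K ybar
        + adjoint \<Phi> (\<Phi> ((1 / t k) *\<^sub>R (x k - xbar)))
        - adjoint \<Phi> ((1 / t k) *\<^sub>R (b k - bbar)) = 0" (is "?L k = 0") for k
    proof -
      note [simp] = linear_scale[OF lin(1)] linear_diff[OF lin(1)]
        linear_scale[OF adjoint_linear[OF lin(1)]] linear_diff[OF adjoint_linear[OF lin(1)]]
        linear_scale[OF adjoint_linear[OF lin(2)]] linear_diff[OF adjoint_linear[OF lin(2)]]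
      have "m k *\<^sub>R (adjoint K (y k) + (1 / m k) *\<^sub>R adjoint \<Phi> (\<Phi> (x k) - b k)) = 0"
        using eqn[of k] by simp
      then have 1: "m k *\<^sub>R adjoint K (y k) + adjoint \<Phi> (\<Phi> (x k) - b k) = 0"
        using m[of k] by (simp add: scaleR_add_right del: linear_diff)
      have "\<mu>bar *\<^sub>R (adjoint K ybar + (1 / \<mu>bar) *\<^sub>R adjoint \<Phi> (\<Phi> xbar - bbar)) = 0"
        using eqn0 by simp
      then have 2: "\<mu>bar *\<^sub>R adjoint K ybar + adjoint \<Phi> (\<Phi> xbar - bbar) = 0"
        using \<mu> by (simp add: scaleR_add_right del: linear_diff)
      have "?L k = (1 / t k) *\<^sub>R ((m k *\<^sub>R adjoint K (y k) + adjoint \<Phi> (\<Phi> (x k) - b k))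
          - (\<mu>bar *\<^sub>R adjoint K ybar + adjoint \<Phi> (\<Phi> xbar - bbar)))"
        by (simp add: algebra_simps diff_divide_distrib)
      then show ?thesis unfolding 1 2 by simp
    qed
    moreover have "?L \<longlonglongrightarrow> \<mu>bar *\<^sub>R adjoint K q + 0 *\<^sub>R adjoint K ybar + adjoint \<Phi> (\<Phi> w) - adjoint \<Phi> 0"
      using conv[OF limm]
      by (intro tendsto_add tendsto_diff tendsto_scaleR tendsto_const bounded_linear.tendsto[OF blK']
          bounded_linear.tendsto[OF bl\<Phi>'] bounded_linear.tendsto[OF bl\<Phi>] limx limy limb limm)
        (simp add: LIM_zero_iff)
    ultimately have "(\<lambda>k. 0) \<longlonglongrightarrow> \<mu>bar *\<^sub>R adjoint K q + adjoint \<Phi> (\<Phi> w)"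
      using linear_0[OF adjoint_linear[OF lin(1)]] by simp
    then show ?thesis using LIMSEQ_unique tendsto_const by blast
  qed
  have energy: "\<mu>bar * (q \<bullet> K w) + (norm (\<Phi> w))\<^sup>2 = 0"
  proof -
    have "w \<bullet> (\<mu>bar *\<^sub>R adjoint K q + adjoint \<Phi> (\<Phi> w)) = 0" unfolding lim_eqn by simp
    then show ?thesis
      by (simp add: inner_add_right adjoint_works[OF lin(1)] adjoint_works[OF lin(2)]
          power2_norm_eq_inner inner_commute)
  qed
  then have nonpos: "q \<bullet> K w \<le> 0"
    using \<mu> by (smt (verit) mult_pos_pos zero_le_power2)

  have lim_inner: "(\<lambda>k. ((1 / t k) *\<^sub>R (y k - ybar)) \<bullet> ((1 / t k) *\<^sub>R (u k - ?u))) \<longlonglongrightarrow> q \<bullet> K w"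
    by (intro tendsto_inner limy limu)
  \<comment> \<open>Both growth conditions bound the same quantity, so they are rescaled once for all.\<close>
  have rescaled: "q \<bullet> K w = 0 \<and> (\<lambda>k. \<delta> k / t k) \<longlonglongrightarrow> 0"
    if "c > 0" and \<delta>: "\<And>k. \<delta> k \<ge> 0"
      and ev: "eventually (\<lambda>k. c / 2 * (\<delta> k)\<^sup>2 \<le> (y k - ybar) \<bullet> (u k - ?u)) sequentially"
    for c \<delta>
  proof -
    let ?I = "\<lambda>k. ((1 / t k) *\<^sub>R (y k - ybar)) \<bullet> ((1 / t k) *\<^sub>R (u k - ?u))"
    have le: "eventually (\<lambda>k. (\<delta> k / t k)\<^sup>2 \<le> 2 / c * ?I k) sequentially"
      using ev
    proof eventually_elim
      case (elim k)
      have "(\<delta> k)\<^sup>2 \<le> 2 / c * ((y k - ybar) \<bullet> (u k - ?u))"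
        using elim \<open>c > 0\<close> by (simp add: field_simps)
      then have "(\<delta> k)\<^sup>2 / (t k)\<^sup>2 \<le> (2 / c * ((y k - ybar) \<bullet> (u k - ?u))) / (t k)\<^sup>2"
        by (rule divide_right_mono) simp
      also have "\<dots> = 2 / c * ?I k" by (simp add: power2_eq_square)
      finally show ?case by (simp add: power_divide)
    qed
    have lim: "(\<lambda>k. 2 / c * ?I k) \<longlonglongrightarrow> 2 / c * (q \<bullet> K w)"
      by (intro tendsto_intros lim_inner)
    have "0 \<le> 2 / c * (q \<bullet> K w)"
      by (rule tendsto_lowerbound[OF lim])
        (use le in \<open>auto elim!: eventually_mono intro: order_trans[OF zero_le_power2]\<close>)
    then have zero: "q \<bullet> K w = 0"
      using nonpos \<open>c > 0\<close> by (simp add: zero_le_divide_iff)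
    have "(\<lambda>k. (\<delta> k / t k)\<^sup>2) \<longlonglongrightarrow> 0"
      by (rule Lim_null_comparison[OF _ lim[unfolded zero mult_zero_right]]) (use le in simp)
    then have "(\<lambda>k. sqrt ((\<delta> k / t k)\<^sup>2)) \<longlonglongrightarrow> sqrt 0" by (rule tendsto_real_sqrt)
    then show ?thesis using zero \<delta> t(1) by (simp add: less_imp_le)
  qed

  have "quadratic_growth g ?u ybar" "quadratic_growth (fenchel_conj g) ybar ?u"
    using growth unfolding primal_dual_quadratic_growth_def by auto
  then obtain c \<epsilon> c' \<epsilon>' where c: "c > 0" "\<epsilon> > 0" "c' > 0" "\<epsilon>' > 0"
      and mono: "\<And>p z. \<lbrakk>norm (p - ?u) < \<epsilon>; z \<in> subdiff g p\<rbrakk> \<Longrightarrow>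
        c / 2 * (infdist p ?\<Omega>)\<^sup>2 \<le> (z - ybar) \<bullet> (p - ?u)"
      and mono': "\<And>p z. \<lbrakk>norm (p - ybar) < \<epsilon>'; z \<in> subdiff (fenchel_conj g) p\<rbrakk> \<Longrightarrow>
        c' / 2 * (infdist p ?\<Omega>')\<^sup>2 \<le> (z - ?u) \<bullet> (p - ybar)"
    unfolding \<Omega>[symmetric] by (metis quadratic_growth_imp_monotone)
  have "eventually (\<lambda>k. norm (u k - ?u) < \<epsilon>) sequentially"
    using tendstoD[OF conv[OF limu] c(2)] by simp
  then have "eventually (\<lambda>k. c / 2 * (infdist (u k) ?\<Omega>)\<^sup>2 \<le> (y k - ybar) \<bullet> (u k - ?u)) sequentially"
    by eventually_elim (intro mono graph')
  from rescaled[OF c(1) infdist_nonneg this]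
  have qK: "q \<bullet> K w = 0" and dist: "(\<lambda>k. infdist (u k) ?\<Omega> / t k) \<longlonglongrightarrow> 0" by auto
  have "eventually (\<lambda>k. norm (y k - ybar) < \<epsilon>') sequentially"
    using tendstoD[OF conv[OF limy] c(4)] by simp
  then have "eventually (\<lambda>k. c' / 2 * (infdist (y k) ?\<Omega>')\<^sup>2 \<le> (y k - ybar) \<bullet> (u k - ?u)) sequentially"
    by eventually_elim (use mono' graph in \<open>metis inner_commute\<close>)
  from rescaled[OF c(3) infdist_nonneg this]
  have dist': "(\<lambda>k. infdist (y k) ?\<Omega>' / t k) \<longlonglongrightarrow> 0" by auto

  have \<Phi>w: "\<Phi> w = 0" using energy qK by simp
  have "K w \<in> tangent_cone ?\<Omega> ?u"
    by (rule tangent_cone_of_infdist[OF _ t limu dist]) (use graph0 in blast)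
  then have w: "w = 0" using primal \<Phi>w by (auto simp: Ker_def)
  have "q \<in> tangent_cone ?\<Omega>' ybar"
    by (rule tangent_cone_of_infdist[OF _ t limy dist']) (use graph0' in blast)
  moreover have "adjoint K q = 0"
    using lim_eqn \<Phi>w \<mu> linear_0[OF adjoint_linear[OF lin(1)]] by simp
  ultimately have "q = 0" using dual by (auto simp: Ker_def)
  with w d show False by (simp add: w_def q_def prod_eq_iff norm_prod_def)
qed

theorem corollary4p10:
  fixes \<Phi> :: "'x::euclidean_space \<Rightarrow> 'e::euclidean_space"
    and K :: "'x \<Rightarrow> 'y::euclidean_space"
    and g :: "'y \<Rightarrow> ereal"
    and bbar :: 'e and \<mu>bar :: real and xbar :: 'x and ybar :: 'y
  assumes "linear \<Phi>" and "linear K"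
    and "proper_fun g" and "lsc_fun g" and "convex_fun g"
    and "\<mu>bar > 0"
    and "(xbar, ybar) \<in> S_LS \<Phi> K g (bbar, \<mu>bar, 0)"
    and "robinson_cq K g xbar"
    and "primal_dual_quadratic_growth g (K xbar) ybar"
    and "(polyhedron (subdiff (fenchel_conj g) ybar) \<and>
            Ker (adjoint K) \<inter> tangent_cone (subdiff g (K xbar)) ybar = {0})
       \<or> (range K \<inter> rel_interior (subdiff (fenchel_conj g) ybar) \<noteq> {} \<and>
            Ker (adjoint K) \<inter> tangent_cone (subdiff g (K xbar)) ybar = {0})
       \<or> Ker (adjoint K) \<inter> normal_cone (subdiff (fenchel_conj g) ybar) (K xbar) = {0}"
  shows "isolated_calm S_LS_domain (S_LS \<Phi> K g) (bbar, \<mu>bar, 0) (xbar, ybar) \<longleftrightarrow>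
    Ker \<Phi> \<inter> K -` tangent_cone (subdiff (fenchel_conj g) ybar) (K xbar) = {0}"
proof -
  let ?T = "Ker \<Phi> \<inter> K -` tangent_cone (subdiff (fenchel_conj g) ybar) (K xbar)"
  have mem: "K xbar \<in> subdiff (fenchel_conj g) ybar"
    using assms(7) by (simp add: mem_S_LS)
  have "0 \<in> tangent_cone (subdiff (fenchel_conj g) ybar) (K xbar)"
    unfolding tangent_cone_def using mem LIMSEQ_Suc[OF lim_1_over_n]
    by (intro CollectI exI[of _ "\<lambda>k. 1 / real (Suc k)"] exI[of _ "\<lambda>k. 0"]) auto
  then have zero: "0 \<in> ?T"
    using assms(1,2) by (simp add: Ker_def linear_0)
  show ?thesis
  proof
    assume "isolated_calm S_LS_domain (S_LS \<Phi> K g) (bbar, \<mu>bar, 0) (xbar, ybar)"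
    from isolated_calm_imp_kernel_tangent_trivial[OF assms(1,2,6) this] zero
    show "?T = {0}" by blast
  next
    assume primal: "?T = {0}"
    have "ybar \<in> subdiff g (K xbar)"
      using mem subdiff_fenchel_conj_iff[OF assms(3-5)] by blast
    from tangent_cone_subdiff_subset_normal_cone[OF this]
    have "tangent_cone (subdiff g (K xbar)) ybar
        \<subseteq> normal_cone (subdiff (fenchel_conj g) ybar) (K xbar)"
      unfolding subdiff_fenchel_conj_iff[OF assms(3-5), symmetric] by simp
    then have "Ker (adjoint K) \<inter> tangent_cone (subdiff g (K xbar)) ybar \<subseteq> {0}"
      using assms(10) by blast
    with primal show "isolated_calm S_LS_domain (S_LS \<Phi> K g) (bbar, \<mu>bar, 0) (xbar, ybar)"
      by (intro isolated_calm_of_kernels_tangent_trivial assms) auto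
  qed
qed

end
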